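(* Suppose a group $G$ acts by homeomorphisms on a dendrite $X$ with no finite orbits. Then the system $(G,X)$ is strongly proximal.
   Context: A dendron is a compact connected Hausdorff space in which every pair of distinct points is separated by a third point (i.e. for distinct $u,v$ there is $w$ such that the complement of $w$ is a union of two disjoint open sets containing $u$ and $v$ respectively); a dendrite is a metrizable dendron. A dynamical system $(G,X)$ with $X$ compact is strongly proximal if for every Borel probability measure $\mu$ on $X$ there are a net $(g_i)$ in $G$ and a point $z\in X$ with $\lim_i g_i\mu=\delta_z$ in the weak-star topology, where $g\mu$ is the push-forward of $\mu$ under $g$ and $\delta_z$ is the point mass at $z$. *)

theory Defs
  imports "HOL-Probability.Probability" "HOL-Algebra.Group_Action"
begin

definition dendron :: "'a topology \<Rightarrow> bool" where
  "dendron X \<longleftrightarrow> compact_space X \<and> connected_space X \<and> Hausdorff_space X \<and>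
     (\<forall>u\<in>topspace X. \<forall>v\<in>topspace X. u \<noteq> v \<longrightarrow>
        (\<exists>w\<in>topspace X. \<exists>U V. openin X U \<and> openin X V \<and> disjnt U V \<and>
           topspace X - {w} = U \<union> V \<and> u \<in> U \<and> v \<in> V))"

definition dendrite :: "'a topology \<Rightarrow> bool" where
  "dendrite X \<longleftrightarrow> dendron X \<and> metrizable_space X"

text \<open>The group carries no topology; the elements of \<open>BijGroup\<close> are extensional
  bijections, so only the values of \<open>\<phi> g\<close> on \<open>topspace X\<close> matter.\<close>

definition acts_by_homeomorphisms ::
    "('g, 'm) monoid_scheme \<Rightarrow> 'a topology \<Rightarrow> ('g \<Rightarrow> 'a \<Rightarrow> 'a) \<Rightarrow> bool" where
  "acts_by_homeomorphisms G X \<phi> \<longleftrightarrow>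
     group_action G (topspace X) \<phi> \<and> (\<forall>g\<in>carrier G. homeomorphic_map X X (\<phi> g))"

definition borel_of :: "'a topology \<Rightarrow> 'a measure" where
  "borel_of X = sigma (topspace X) {U. openin X U}"

definition borel_prob_measures :: "'a topology \<Rightarrow> 'a measure set" where
  "borel_prob_measures X = {\<mu>. prob_space \<mu> \<and> sets \<mu> = sets (borel_of X)}"

text \<open>The coarsest topology on the Borel probability measures that makes
  \<open>\<mu> \<mapsto> \<integral>x. f x \<partial>\<mu>\<close> continuous for every continuous \<open>f\<close>, obtained by pulling
  back the product topology on families of reals indexed by the continuous functions.
  It is meant for compact \<open>X\<close>, where every such \<open>f\<close> is bounded.\<close>

definition weak_star_topology :: "'a topology \<Rightarrow> 'a measure topology" where
  "weak_star_topology X =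
     pullback_topology (borel_prob_measures X)
       (\<lambda>\<mu>. \<lambda>f\<in>{f. continuous_map X euclideanreal f}. \<integral>x. f x \<partial>\<mu>)
       (product_topology (\<lambda>_. euclideanreal) {f. continuous_map X euclideanreal f})"

text \<open>Nets in \<open>G\<close> are rendered, as usual in HOL, by proper filters \<open>F\<close> on the carrier:
  a net induces the filter of the sets that eventually contain it, and conversely \<open>F\<close> is
  induced in this way by the net \<open>(S, g) \<mapsto> g\<close> indexed by the pairs with \<open>g \<in> S\<close>,
  \<open>S \<subseteq> carrier G\<close> and \<open>eventually (\<lambda>h. h \<in> S) F\<close>, directed by reverse inclusion of \<open>S\<close>.
  Both passages preserve the limits.\<close>

definition strongly_proximal ::
    "('g, 'm) monoid_scheme \<Rightarrow> 'a topology \<Rightarrow> ('g \<Rightarrow> 'a \<Rightarrow> 'a) \<Rightarrow> bool" where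
  "strongly_proximal G X \<phi> \<longleftrightarrow>
     (\<forall>\<mu>\<in>borel_prob_measures X. \<exists>F. \<exists>z\<in>topspace X.
        F \<noteq> bot \<and> F \<le> principal (carrier G) \<and>
        limitin (weak_star_topology X) (\<lambda>g. distr \<mu> (borel_of X) (\<phi> g))
          (return (borel_of X) z) F)"

end

theory Submission
  imports Defs
begin

text \<open>
  Let \<open>Y\<close> be a minimal nonempty invariant subcontinuum. Subcontinua of a dendron have the Helly
  property, so every subcontinuum \<open>K\<close> that meets but does not contain \<open>Y\<close> is disjoint from one of
  its translates: otherwise \<open>Y\<close> and all translates of \<open>K\<close> would have a common point, contradicting
  minimality. Applied to the complement of a half-tree \<open>C\<close> (open, connected, with connected
  complement), this gives \<open>g\<close> mapping the complement of \<open>C\<close> into \<open>C\<close>. As there are no finite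
  orbits, \<open>Y\<close> has three endpoints, hence three disjoint half-trees around their median, and
  ping-pong produces arbitrarily many disjoint half-trees. In a compact metrizable dendron all
  but boundedly many of them have diameter less than \<open>\<epsilon>\<close>, and one of the small ones has small
  \<open>\<mu>\<close>-measure; the corresponding \<open>g\<close> moves almost all of \<open>\<mu>\<close> into that small half-tree.
\<close>

section \<open>Subcontinua of a dendron\<close>

text \<open>Complementation reverses inclusion, so this is the upward form of Zorn's lemma applied
  to the complements. Only nonempty chains need a lower bound, since any member of
  \<open>\<A>\<close> serves the empty one.\<close>

lemma subset_Zorn_minimal:
  assumes "\<A> \<noteq> {}"
    and lower: "\<And>\<C>. \<C> \<noteq> {} \<Longrightarrow> subset.chain \<A> \<C> \<Longrightarrow> \<exists>L\<in>\<A>. \<forall>S\<in>\<C>. L \<subseteq> S"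
  shows "\<exists>M\<in>\<A>. \<forall>S\<in>\<A>. S \<subseteq> M \<longrightarrow> S = M"
proof -
  have "\<exists>M\<in>uminus ` \<A>. \<forall>S\<in>uminus ` \<A>. M \<subseteq> S \<longrightarrow> S = M"
  proof (rule subset_Zorn)
    fix \<C> assume \<C>: "subset.chain (uminus ` \<A>) \<C>"
    show "\<exists>U\<in>uminus ` \<A>. \<forall>S\<in>\<C>. S \<subseteq> U"
    proof (cases "\<C> = {}")
      case True
      then show ?thesis using \<open>\<A> \<noteq> {}\<close> by auto
    next
      case False
      have "subset.chain \<A> (uminus ` \<C>)"
        using \<C> by (auto simp: subset_chain_def image_iff subset_iff) (metis double_complement)+
      with lower[of "uminus ` \<C>"] False obtain L where "L \<in> \<A>" "\<forall>S\<in>\<C>. L \<subseteq> - S"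
        by auto
      then show ?thesis by (intro bexI[of _ "- L"]) auto
    qed
  qed
  then obtain M where "M \<in> \<A>" "\<forall>S\<in>\<A>. - M \<subseteq> - S \<longrightarrow> - S = - M" by auto
  then show ?thesis by (intro bexI[of _ M]) auto
qed

text \<open>The intersection of a nonempty finite subfamily of a chain is one of its members, so the
  traces on \<open>A\<close> have the finite intersection property. This provides the lower bounds
  in the applications of Zorn's lemma.\<close>

lemma compact_space_chain_Inter_nonempty:
  assumes "compact_space X" "subset.chain \<A> \<C>" "\<C> \<noteq> {}" "closedin X A"
    and "\<And>S. S \<in> \<C> \<Longrightarrow> closedin X S" "\<And>S. S \<in> \<C> \<Longrightarrow> S \<inter> A \<noteq> {}"
  shows "\<Inter>\<C> \<inter> A \<noteq> {}"
proof -
  have "\<Inter>((\<lambda>S. S \<inter> A) ` \<C>) \<noteq> {}"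
  proof (rule compact_space_fip[THEN iffD1, OF assms(1), rule_format], safe)
    fix S assume "S \<in> \<C>"
    then show "closedin X (S \<inter> A)" using assms by auto
  next
    fix \<F> assume fin: "finite \<F>" "\<F> \<subseteq> (\<lambda>S. S \<inter> A) ` \<C>" and empty: "\<Inter>\<F> = {}"
    obtain \<G> where \<G>: "\<G> \<subseteq> \<C>" "finite \<G>" "\<F> = (\<lambda>S. S \<inter> A) ` \<G>"
      using finite_subset_image[OF fin] by blast
    have ne: "\<G> \<noteq> {}" using empty \<G> by auto
    have "subset.chain \<A> \<G>" using assms(2) \<G> by (meson subset_chain_def subset_iff)
    then have "\<Inter>\<G> \<in> \<C>" using Inter_in_chain \<G> ne by blast
    then have "\<Inter>\<G> \<inter> A \<noteq> {}" using assms(6) by blast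
    then show False using empty \<G> ne by auto
  qed
  then show ?thesis using \<open>\<C> \<noteq> {}\<close> by auto
qed

section \<open>Cuts, convexity and connectedness\<close>

locale dendron_space =
  fixes X :: "'a topology"
  assumes dendron: "dendron X"
begin

lemma compact: "compact_space X"
  and connected: "connected_space X"
  using dendron by (auto simp: dendron_def)

text \<open>Neither part has to be nonempty, so \<open>w\<close> need not disconnect the space. This
  lets \<open>cut_side\<close> hold at every point \<open>p\<close>, even one whose complement is
  connected.\<close>

definition cut :: "'a \<Rightarrow> 'a set \<Rightarrow> 'a set \<Rightarrow> bool" where
  "cut w U V \<longleftrightarrow> w \<in> topspace X \<and> openin X U \<and> openin X V \<and> disjnt U V \<and> topspace X - {w} = U \<union> V"

lemma cut_sym: "cut w U V \<Longrightarrow> cut w V U"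
  by (auto simp: cut_def disjnt_sym)

lemma ex_cut:
  assumes "u \<in> topspace X" "v \<in> topspace X" "u \<noteq> v"
  obtains w U V where "cut w U V" "u \<in> U" "v \<in> V"
  using dendron assms unfolding dendron_def cut_def by blast

lemma closedin_cut:
  assumes "cut w U V" shows "closedin X (insert w U)"
proof -
  have "insert w U = topspace X - V"
    using assms by (auto simp: cut_def disjnt_iff dest: openin_subset)
  then show ?thesis using assms by (auto simp: cut_def)
qed

text \<open>In a splitting of \<open>insert w U\<close> into closed parts, the part without
  \<open>w\<close> equals \<open>U\<close> minus the part with \<open>w\<close>. It is therefore
  also open in \<open>X\<close>, which contradicts the connectedness of \<open>X\<close>.\<close>

lemma connectedin_cut:
  assumes "cut w U V" shows "connectedin X (insert w U)"
  unfolding connectedin_closedin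
proof (intro conjI notI)
  show "insert w U \<subseteq> topspace X" using closedin_cut[OF assms] closedin_subset by blast
  assume "\<exists>E1 E2. closedin X E1 \<and> closedin X E2 \<and> insert w U \<subseteq> E1 \<union> E2 \<and>
    E1 \<inter> E2 \<inter> insert w U = {} \<and> E1 \<inter> insert w U \<noteq> {} \<and> E2 \<inter> insert w U \<noteq> {}"
  then obtain A B where AB: "closedin X A" "closedin X B" "insert w U \<subseteq> A \<union> B"
    "A \<inter> B \<inter> insert w U = {}" "B \<inter> insert w U \<noteq> {}" "w \<in> A"
    by (smt (verit, best) Int_commute Un_commute Un_iff insert_subset)
  define E where "E = B \<inter> insert w U"
  have "closedin X E" unfolding E_def using AB closedin_cut[OF assms] by (intro closedin_Int)
  moreover have "E = U - A" using AB by (auto simp: E_def)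
  then have "openin X E" using AB assms by (auto simp: cut_def)
  ultimately have "E = topspace X"
    using connected AB E_def by (auto simp: connected_space_clopen_in)
  then show False using AB assms by (auto simp: E_def cut_def)
qed

text \<open>A substitute for connectedness that passes to arbitrary intersections at once. Connected
  sets have it, and for closed sets it is equivalent to connectedness.\<close>

definition cut_convex :: "'a set \<Rightarrow> bool" where
  "cut_convex S \<longleftrightarrow> S \<subseteq> topspace X \<and> (\<forall>w U V. cut w U V \<longrightarrow> S \<inter> U \<noteq> {} \<longrightarrow> S \<inter> V \<noteq> {} \<longrightarrow> w \<in> S)"

lemma connectedin_imp_cut_convex:
  assumes "connectedin X S" shows "cut_convex S"
  unfolding cut_convex_def
proof (intro conjI allI impI)
  show "S \<subseteq> topspace X" using assms connectedin_subset_topspace by blast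
  fix w U V assume "cut w U V" "S \<inter> U \<noteq> {}" "S \<inter> V \<noteq> {}"
  with assms connectedinD[of X S U V] \<open>S \<subseteq> topspace X\<close> show "w \<in> S"
    by (auto simp: cut_def disjnt_def)
qed

lemma cut_convex_Int: "cut_convex S \<Longrightarrow> cut_convex T \<Longrightarrow> cut_convex (S \<inter> T)"
  unfolding cut_convex_def by blast

lemma cut_convex_Inter: "\<C> \<noteq> {} \<Longrightarrow> (\<And>S. S \<in> \<C> \<Longrightarrow> cut_convex S) \<Longrightarrow> cut_convex (\<Inter>\<C>)"
  unfolding cut_convex_def by blast

lemma cut_convex_cut: "cut w U V \<Longrightarrow> cut_convex (insert w U)"
  using connectedin_cut connectedin_imp_cut_convex by blast

text \<open>If a closed convex set split into closed parts \<open>A\<close> and \<open>B\<close>, a minimal closed convex set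
  meeting both parts could be made smaller by cutting it at a point separating a point
  of \<open>A\<close> from a point of \<open>B\<close>.\<close>

lemma closed_cut_convex_imp_connectedin:
  assumes S: "closedin X S" "cut_convex S"
  shows "connectedin X S"
  unfolding connectedin_closedin
proof (intro conjI notI)
  show "S \<subseteq> topspace X" using S closedin_subset by blast
  assume "\<exists>E1 E2. closedin X E1 \<and> closedin X E2 \<and> S \<subseteq> E1 \<union> E2 \<and>
    E1 \<inter> E2 \<inter> S = {} \<and> E1 \<inter> S \<noteq> {} \<and> E2 \<inter> S \<noteq> {}"
  then obtain A B where AB: "closedin X A" "closedin X B" "S \<subseteq> A \<union> B"
    "A \<inter> B \<inter> S = {}" "S \<inter> A \<noteq> {}" "S \<inter> B \<noteq> {}" by blast
  define \<T> where "\<T> = {T. closedin X T \<and> cut_convex T \<and> T \<subseteq> S \<and> T \<inter> A \<noteq> {} \<and> T \<inter> B \<noteq> {}}"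
  have "\<exists>M\<in>\<T>. \<forall>T\<in>\<T>. T \<subseteq> M \<longrightarrow> T = M"
  proof (rule subset_Zorn_minimal)
    show "\<T> \<noteq> {}" using S AB by (auto simp: \<T>_def)
    fix \<C> assume \<C>: "\<C> \<noteq> {}" "subset.chain \<T> \<C>"
    then have sub: "\<C> \<subseteq> \<T>" by (auto simp: subset_chain_def)
    have "closedin X (\<Inter>\<C>)" "cut_convex (\<Inter>\<C>)" "\<Inter>\<C> \<subseteq> S"
      using \<C>(1) sub by (auto simp: \<T>_def intro!: closedin_Inter cut_convex_Inter)
    moreover have "\<Inter>\<C> \<inter> A \<noteq> {}" "\<Inter>\<C> \<inter> B \<noteq> {}"
      using compact_space_chain_Inter_nonempty[OF compact \<C>(2,1)] AB sub
      by (auto simp: \<T>_def subset_iff)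
    ultimately have "\<Inter>\<C> \<in> \<T>" by (auto simp: \<T>_def)
    then show "\<exists>L\<in>\<T>. \<forall>S\<in>\<C>. L \<subseteq> S" by blast
  qed
  then obtain M where M: "M \<in> \<T>" and min: "\<And>T. T \<in> \<T> \<Longrightarrow> T \<subseteq> M \<Longrightarrow> T = M" by blast
  obtain a b where ab: "a \<in> M" "a \<in> A" "b \<in> M" "b \<in> B" using M by (auto simp: \<T>_def)
  moreover have "M \<subseteq> topspace X" "M \<subseteq> S" using M closedin_subset[of X M] by (auto simp: \<T>_def)
  ultimately have "a \<noteq> b" "a \<in> topspace X" "b \<in> topspace X" using AB by auto
  then obtain w U V where cut: "cut w U V" "a \<in> U" "b \<in> V" using ex_cut by blast
  then have w: "w \<in> M" using M ab unfolding \<T>_def cut_convex_def by blast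
  have disj: "a \<notin> insert w V" "b \<notin> insert w U"
    using cut by (auto simp: cut_def disjnt_iff)
  have clo: "closedin X (M \<inter> insert w U)" "cut_convex (M \<inter> insert w U)"
    "closedin X (M \<inter> insert w V)" "cut_convex (M \<inter> insert w V)"
    using M closedin_cut[OF cut(1)] closedin_cut[OF cut_sym[OF cut(1)]]
      cut_convex_cut[OF cut(1)] cut_convex_cut[OF cut_sym[OF cut(1)]]
    unfolding \<T>_def by (blast intro: cut_convex_Int closedin_Int)+
  show False
  \<comment> \<open>The smaller set keeps \<open>w\<close>, which represents the part it belongs to,
    and keeps the side of the point \<open>a\<close> or \<open>b\<close> that represents the other
    part.\<close>
  proof (cases "w \<in> A")
    case True
    then have "M \<inter> insert w V \<in> \<T>" using clo M w ab cut by (auto simp: \<T>_def)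
    then show False using min[of "M \<inter> insert w V"] disj ab by blast
  next
    case False
    then have "w \<in> B" using w M AB by (auto simp: \<T>_def)
    then have "M \<inter> insert w U \<in> \<T>" using clo M w ab cut by (auto simp: \<T>_def)
    then show False using min[of "M \<inter> insert w U"] disj ab by blast
  qed
qed

section \<open>Intersections of subcontinua and the Helly property\<close>

text \<open>The empty set counts as a continuum, so that intersections of continua are continua
  without exception; nonemptiness is always stated separately.\<close>

definition continuum :: "'a set \<Rightarrow> bool" where
  "continuum K \<longleftrightarrow> closedin X K \<and> connectedin X K"

lemma continuum_cut: "cut w U V \<Longrightarrow> continuum (insert w U)"
  using closedin_cut connectedin_cut by (simp add: continuum_def)

lemma continuum_topspace: "continuum (topspace X)"
  using connected by (simp add: continuum_def connectedin_topspace)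

lemma continuum_Inter:
  assumes "\<C> \<noteq> {}" "\<And>K. K \<in> \<C> \<Longrightarrow> continuum K"
  shows "continuum (\<Inter>\<C>)"
  unfolding continuum_def
proof
  show "closedin X (\<Inter>\<C>)" using assms by (auto simp: continuum_def)
  moreover have "cut_convex (\<Inter>\<C>)"
    using assms connectedin_imp_cut_convex by (intro cut_convex_Inter) (auto simp: continuum_def)
  ultimately show "connectedin X (\<Inter>\<C>)" by (rule closed_cut_convex_imp_connectedin)
qed

lemma continuum_Int: "continuum K \<Longrightarrow> continuum L \<Longrightarrow> continuum (K \<inter> L)"
  using continuum_Inter[of "{K, L}"] by auto

lemma continuum_Un: "continuum K \<Longrightarrow> continuum L \<Longrightarrow> K \<inter> L \<noteq> {} \<Longrightarrow> continuum (K \<union> L)"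
  by (auto simp: continuum_def intro: connectedin_Un)

text \<open>The set \<open>K \<inter> (L \<union> M)\<close> is connected as an intersection of two
  continua. With an empty triple intersection it would split into the disjoint nonempty closed sets
  \<open>K \<inter> L\<close> and \<open>K \<inter> M\<close>.\<close>

lemma continuum_Int3_nonempty:
  assumes "continuum K" "continuum L" "continuum M"
    and "K \<inter> L \<noteq> {}" "K \<inter> M \<noteq> {}" "L \<inter> M \<noteq> {}"
  shows "K \<inter> L \<inter> M \<noteq> {}"
proof
  assume empty: "K \<inter> L \<inter> M = {}"
  have "connectedin X (K \<inter> (L \<union> M))"
    using continuum_Int[OF assms(1) continuum_Un[OF assms(2,3,6)]] by (simp add: continuum_def)
  moreover have "closedin X (K \<inter> L)" "closedin X (K \<inter> M)" using assms by (auto simp: continuum_def)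
  ultimately have "closedin X (K \<inter> L) \<and> closedin X (K \<inter> M) \<and> K \<inter> (L \<union> M) \<subseteq> K \<inter> L \<union> K \<inter> M \<and>
    (K \<inter> L) \<inter> (K \<inter> M) \<inter> (K \<inter> (L \<union> M)) = {} \<and> (K \<inter> L) \<inter> (K \<inter> (L \<union> M)) \<noteq> {} \<and> (K \<inter> M) \<inter> (K \<inter> (L \<union> M)) \<noteq> {}"
    using assms empty by blast
  with \<open>connectedin X (K \<inter> (L \<union> M))\<close> show False
    unfolding connectedin_closedin by blast
qed

text \<open>Induction on the number of sets: one member \<open>K\<close> is removed and the others
  are replaced by their traces on \<open>K\<close>, which still meet pairwise by the case of three
  continua.\<close>

lemma finite_continuum_Inter_nonempty:
  assumes "finite \<F>" "\<F> \<noteq> {}" "\<And>K. K \<in> \<F> \<Longrightarrow> continuum K"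
    and "\<And>K L. K \<in> \<F> \<Longrightarrow> L \<in> \<F> \<Longrightarrow> K \<inter> L \<noteq> {}"
  shows "\<Inter>\<F> \<noteq> {}"
  using assms
proof (induction "card \<F>" arbitrary: \<F> rule: less_induct)
  case less
  obtain K where K: "K \<in> \<F>" using less by blast
  show ?case
  proof (cases "\<F> = {K}")
    case True
    then show ?thesis using less.prems(4)[OF K K] by auto
  next
    case False
    define \<G> where "\<G> = (\<lambda>L. K \<inter> L) ` (\<F> - {K})"
    have "card \<G> < card \<F>"
      unfolding \<G>_def using less K by (meson card_Diff1_less card_image_le finite_Diff le_less_trans)
    moreover have "finite \<G>" "\<G> \<noteq> {}" using less False K by (auto simp: \<G>_def)
    moreover have "continuum L" if "L \<in> \<G>" for L
      using that less K by (auto simp: \<G>_def intro: continuum_Int)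
    moreover have "L \<inter> M \<noteq> {}" if LM: "L \<in> \<G>" "M \<in> \<G>" for L M
    proof -
      obtain L' M' where *: "L = K \<inter> L'" "M = K \<inter> M'" "L' \<in> \<F>" "M' \<in> \<F>" using LM by (auto simp: \<G>_def)
      then have "K \<inter> L' \<inter> M' \<noteq> {}" using less.prems K by (intro continuum_Int3_nonempty) auto
      then show ?thesis using * by blast
    qed
    ultimately have "\<Inter>\<G> \<noteq> {}" using less.hyps by blast
    moreover have "\<Inter>\<G> \<subseteq> \<Inter>\<F>" using \<open>\<G> \<noteq> {}\<close> by (auto simp: \<G>_def)
    ultimately show ?thesis by blast
  qed
qed

lemma continuum_Inter_nonempty:
  assumes "\<C> \<noteq> {}" "\<And>K. K \<in> \<C> \<Longrightarrow> continuum K"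
    and "\<And>K L. K \<in> \<C> \<Longrightarrow> L \<in> \<C> \<Longrightarrow> K \<inter> L \<noteq> {}"
  shows "\<Inter>\<C> \<noteq> {}"
proof (rule compact_space_fip[THEN iffD1, OF compact, rule_format], safe)
  fix K assume "K \<in> \<C>" then show "closedin X K" using assms(2) by (simp add: continuum_def)
next
  fix \<F> assume \<F>: "finite \<F>" "\<F> \<subseteq> \<C>" and empty: "\<Inter>\<F> = {}"
  show False
  proof (cases "\<F> = {}")
    case False
    then show False using finite_continuum_Inter_nonempty[of \<F>] assms \<F> empty by (meson subsetD)
  qed (use empty in simp)
qed

section \<open>Sides of a point\<close>

text \<open>\<open>side p a\<close> is the component of \<open>a\<close> in the complement of \<open>p\<close>.\<close>

definition side :: "'a \<Rightarrow> 'a \<Rightarrow> 'a set" where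
  "side p a = \<Union>{U. \<exists>w V. cut w U V \<and> a \<in> U \<and> p \<in> V}"

lemma mem_sideE:
  assumes "x \<in> side p a"
  obtains w U V where "cut w U V" "a \<in> U" "x \<in> U" "p \<in> V"
  using assms unfolding side_def by blast

lemma mem_sideI: "cut w U V \<Longrightarrow> a \<in> U \<Longrightarrow> x \<in> U \<Longrightarrow> p \<in> V \<Longrightarrow> x \<in> side p a"
  unfolding side_def by blast

lemma side_subset: "side p a \<subseteq> topspace X"
  by (auto elim!: mem_sideE simp: cut_def dest: openin_subset)

lemma side_refl: "a \<in> topspace X \<Longrightarrow> p \<in> topspace X \<Longrightarrow> p \<noteq> a \<Longrightarrow> a \<in> side p a"
  by (metis ex_cut mem_sideI)

lemma side_sym: "x \<in> side p a \<Longrightarrow> a \<in> side p x"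
  by (erule mem_sideE) (rule mem_sideI)

lemma not_mem_side: "p \<notin> side p a"
  by (auto elim!: mem_sideE simp: cut_def disjnt_iff)

lemma openin_side: "openin X (side p a)"
  unfolding side_def by (auto simp: cut_def)

lemma cut_connectedin_subset:
  assumes "cut w U V" "connectedin X S" "w \<notin> S" "S \<inter> U \<noteq> {}"
  shows "S \<subseteq> U"
proof -
  have "S \<inter> V = {}" "S \<subseteq> topspace X"
    using connectedin_imp_cut_convex[OF assms(2)] assms unfolding cut_convex_def by blast+
  moreover have "topspace X - {w} = U \<union> V" using assms(1) by (simp add: cut_def)
  ultimately show ?thesis using assms(3) by blast
qed

text \<open>Together with \<open>side_refl\<close> and \<open>side_sym\<close> this makes lying on
  the same side of \<open>p\<close> an equivalence relation on the other points. The positions of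
  the two cut points decide which of the two cuts, or which combination, separates both
  \<open>a\<close> and \<open>y\<close> from \<open>p\<close>.\<close>

lemma side_trans:
  assumes "x \<in> side p a" "y \<in> side p x"
  shows "y \<in> side p a"
proof -
  obtain w U V where c: "cut w U V" "a \<in> U" "x \<in> U" "p \<in> V" using assms(1) by (rule mem_sideE)
  obtain w' U' V' where c': "cut w' U' V'" "x \<in> U'" "y \<in> U'" "p \<in> V'" using assms(2) by (rule mem_sideE)
  have sub: "w \<in> topspace X" "w' \<in> topspace X" "topspace X - {w'} = U' \<union> V'" "topspace X - {w} = U \<union> V"
    using c c' by (auto simp: cut_def)
  consider "w' = w" | "w' \<in> V" | "w' \<in> U" "w \<in> V'" | "w' \<in> U" "w \<in> U'"
    using sub by auto
  then show ?thesis
  proof cases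
    case 1
    then have "cut w (U \<union> U') (V \<inter> V')" using c c' by (auto simp: cut_def disjnt_iff)
    then show ?thesis using c c' by (auto intro: mem_sideI)
  next
    case 2
    then have "insert w U \<subseteq> U'"
      using c c' by (intro cut_connectedin_subset[OF c'(1) connectedin_cut[OF c(1)]])
        (auto simp: cut_def disjnt_iff)
    then show ?thesis using c c' by (auto intro: mem_sideI)
  next
    case 3
    then have "insert w' U' \<subseteq> U"
      using c c' by (intro cut_connectedin_subset[OF c(1) connectedin_cut[OF c'(1)]])
        (auto simp: cut_def disjnt_iff)
    then show ?thesis using c c' by (auto intro: mem_sideI)
  next
    case 4
    \<comment> \<open>This case is impossible: \<open>insert w V\<close> avoids \<open>w'\<close>
      and contains \<open>p\<close>, so it lies in \<open>V'\<close>, although \<open>w\<close> lies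
      in \<open>U'\<close>.\<close>
    then have "insert w V \<subseteq> V'"
      using c c' by (intro cut_connectedin_subset[OF cut_sym[OF c'(1)] connectedin_cut[OF cut_sym[OF c(1)]]])
        (auto simp: cut_def disjnt_iff)
    then show ?thesis using 4 c c' by (auto simp: cut_def disjnt_iff)
  qed
qed

lemma disjnt_side: "b \<notin> side p a \<Longrightarrow> disjnt (side p a) (side p b)"
  by (metis disjnt_iff side_sym side_trans)

text \<open>The side is a union of connected sets \<open>insert w U\<close> through
  \<open>a\<close>. The point to check is that \<open>w\<close> itself belongs to the side: a cut
  point \<open>w'\<close> between \<open>w\<close> and \<open>p\<close> must lie in
  \<open>V\<close>, so the cut at \<open>w'\<close> keeps all of \<open>insert w U\<close> away from
  \<open>p\<close>.\<close>

lemma connectedin_side: "connectedin X (side p a)"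
proof (cases "side p a = {}")
  case False
  define \<U> where "\<U> = {insert w U |w U. \<exists>V. cut w U V \<and> a \<in> U \<and> p \<in> V}"
  have "insert w U \<subseteq> side p a" if c: "cut w U V" "a \<in> U" "p \<in> V" for w U V
  proof -
    have "w \<noteq> p" "w \<in> topspace X" "p \<in> topspace X"
      using c by (auto simp: cut_def)
    then obtain w' U' V' where c': "cut w' U' V'" "w \<in> U'" "p \<in> V'" using ex_cut by blast
    have "w' \<in> insert w V"
    proof (rule ccontr)
      assume "w' \<notin> insert w V"
      then have "insert w V \<subseteq> U'"
        using c' by (intro cut_connectedin_subset[OF c'(1) connectedin_cut[OF cut_sym[OF c(1)]]]) auto
      then show False using c c' by (auto simp: cut_def disjnt_iff)
    qed
    then have "w' \<notin> insert w U" using c c' by (auto simp: cut_def disjnt_iff)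
    then have "insert w U \<subseteq> U'"
      using c' by (intro cut_connectedin_subset[OF c'(1) connectedin_cut[OF c(1)]]) auto
    then show ?thesis using mem_sideI[OF c'(1) _ _ c'(3)] c by blast
  qed
  then have "side p a = \<Union>\<U>" unfolding \<U>_def side_def by blast
  moreover have "connectedin X (\<Union>\<U>)"
  proof (rule connectedin_Union)
    show "connectedin X S" if "S \<in> \<U>" for S
      using that connectedin_cut by (auto simp: \<U>_def)
    have "a \<in> \<Inter>\<U>" by (auto simp: \<U>_def)
    then show "\<Inter>\<U> \<noteq> {}" by blast
  qed
  ultimately show ?thesis by simp
qed simp

text \<open>What remains of the punctured space is the union of the other sides, hence open.\<close>

lemma cut_side:
  assumes "p \<in> topspace X"
  shows "cut p (side p a) (topspace X - {p} - side p a)"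
proof -
  have "topspace X - {p} - side p a = \<Union>{side p b |b. b \<in> topspace X - {p} - side p a}" (is "?L = ?R")
  proof
    show "?L \<subseteq> ?R" using side_refl assms by blast
    show "?R \<subseteq> ?L"
    proof
      fix x assume "x \<in> ?R"
      then obtain b where b: "x \<in> side p b" "b \<notin> side p a" by blast
      then show "x \<in> ?L"
        using side_subset[of p b] not_mem_side[of p b] disjnt_side[OF b(2)] by (auto simp: disjnt_iff)
    qed
  qed
  moreover have "openin X ?R" using openin_side by blast
  ultimately have "openin X (topspace X - {p} - side p a)" by (rule ssubst)
  then show ?thesis
    using assms openin_side[of p a] side_subset[of p a] not_mem_side[of p a]
    by (auto simp: cut_def disjnt_iff)
qed

lemma connectedin_subset_side:
  assumes "connectedin X S" "p \<in> topspace X - S" "a \<in> S"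
  shows "S \<subseteq> side p a"
proof (rule cut_connectedin_subset[OF cut_side])
  have "a \<in> side p a"
    using side_refl[of a p] assms connectedin_subset_topspace[OF assms(1)] by blast
  then show "S \<inter> side p a \<noteq> {}" using assms(3) by blast
qed (use assms in auto)

lemma continuum_Diff_side: "p \<in> topspace X \<Longrightarrow> continuum (topspace X - side p a)"
proof -
  assume p: "p \<in> topspace X"
  then have "topspace X - side p a = insert p (topspace X - {p} - side p a)"
    using not_mem_side by auto
  then show ?thesis using continuum_cut[OF cut_sym[OF cut_side[OF p]]] by metis
qed

section \<open>Endpoints, hulls and medians\<close>

text \<open>A non-cut point relative to the subcontinuum \<open>Y\<close>; the whole space may well
  be disconnected by removing \<open>e\<close>.\<close>

definition endpoint :: "'a set \<Rightarrow> 'a \<Rightarrow> bool" where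
  "endpoint Y e \<longleftrightarrow> e \<in> Y \<and> connectedin X (Y - {e})"

text \<open>Moving away from a base point \<open>y\<close> inside \<open>Y\<close> as far as
  possible ends at an endpoint. Zorn's lemma and compactness provide a point of \<open>Y\<close>
  with nothing of \<open>Y\<close> behind it.\<close>

lemma ex_endpoint:
  assumes Y: "continuum Y" and "y \<in> Y" "y' \<in> Y" "y \<noteq> y'"
  obtains e where "endpoint Y e"
proof -
  have YX: "Y \<subseteq> topspace X" using Y closedin_subset by (auto simp: continuum_def)
  \<comment> \<open>For \<open>p \<noteq> y\<close> this is \<open>p\<close> together with
    everything behind \<open>p\<close> as seen from \<open>y\<close>; it shrinks as \<open>p\<close>
    moves away from \<open>y\<close>.\<close>
  define T where "T p = topspace X - side p y" for p
  have T_mono: "T q \<subseteq> T p" if "q \<in> T p" "q \<noteq> y" "p \<noteq> y" "p \<in> topspace X" for p q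
  proof (cases "q = p")
    case False
    have "insert p (side p y) \<subseteq> side q y"
    proof (rule connectedin_subset_side)
      show "connectedin X (insert p (side p y))" using connectedin_cut cut_side that by blast
      show "q \<in> topspace X - insert p (side p y)" using that False by (auto simp: T_def)
      show "y \<in> insert p (side p y)" using that side_refl assms YX by auto
    qed
    then show ?thesis by (auto simp: T_def)
  qed simp
  define \<T> where "\<T> = T ` (Y - {y})"
  have "\<exists>M\<in>\<T>. \<forall>S\<in>\<T>. S \<subseteq> M \<longrightarrow> S = M"
  proof (rule subset_Zorn_minimal)
    show "\<T> \<noteq> {}" using assms by (auto simp: \<T>_def)
    fix \<C> assume \<C>: "\<C> \<noteq> {}" "subset.chain \<T> \<C>"
    then have sub: "\<C> \<subseteq> \<T>" by (auto simp: subset_chain_def)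
    \<comment> \<open>Any common point \<open>q\<close> in \<open>Y\<close> lies behind all points
      of the chain, so \<open>T q\<close> is a lower bound.\<close>
    have "\<Inter>\<C> \<inter> Y \<noteq> {}"
    proof (rule compact_space_chain_Inter_nonempty[OF compact \<C>(2,1)])
      show "closedin X Y" using Y by (simp add: continuum_def)
      fix S assume "S \<in> \<C>"
      then obtain p where p: "p \<in> Y" "S = T p" using sub by (auto simp: \<T>_def)
      show "closedin X S" unfolding p T_def using openin_side by blast
      show "S \<inter> Y \<noteq> {}" unfolding p T_def using not_mem_side p YX by blast
    qed
    then obtain q where q: "q \<in> \<Inter>\<C>" "q \<in> Y" by blast
    have "T q \<in> \<T>"
    proof -
      obtain S where "S \<in> \<C>" using \<C>(1) by blast
      moreover obtain p where "S = T p" "p \<in> Y" "p \<noteq> y" using calculation sub by (auto simp: \<T>_def)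
      ultimately have "q \<in> T p" "p \<in> Y" "p \<noteq> y" using q by auto
      then have "q \<noteq> y" using side_refl assms YX by (auto simp: T_def)
      then show ?thesis using q by (auto simp: \<T>_def)
    qed
    moreover have "T q \<subseteq> S" if "S \<in> \<C>" for S
    proof -
      obtain p where "p \<in> Y" "S = T p" "p \<noteq> y" using sub \<open>S \<in> \<C>\<close> by (auto simp: \<T>_def)
      moreover have "q \<noteq> y"
        using calculation q \<open>S \<in> \<C>\<close> side_refl[of y p] assms YX by (auto simp: T_def subset_iff)
      ultimately show ?thesis using T_mono[of q p] q \<open>S \<in> \<C>\<close> YX by auto
    qed
    ultimately show "\<exists>L\<in>\<T>. \<forall>S\<in>\<C>. L \<subseteq> S" by blast
  qed
  then obtain e where e: "e \<in> Y" "e \<noteq> y" and min: "\<And>p. p \<in> Y \<Longrightarrow> p \<noteq> y \<Longrightarrow> T p \<subseteq> T e \<Longrightarrow> T p = T e"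
    by (auto simp: \<T>_def)
  have sub: "Y - {e} \<subseteq> side e y"
  proof
    fix a assume a: "a \<in> Y - {e}"
    show "a \<in> side e y"
    proof (rule ccontr)
      assume "a \<notin> side e y"
      then have aT: "a \<in> T e" "a \<noteq> y" using a YX e side_refl assms by (auto simp: T_def)
      then have "T a = T e" using min[of a] T_mono[of a e] a e YX by auto
      moreover have "insert e (side e y) \<subseteq> side a y"
      proof (rule connectedin_subset_side)
        show "connectedin X (insert e (side e y))" using connectedin_cut cut_side e YX by blast
        show "a \<in> topspace X - insert e (side e y)" using aT a by (auto simp: T_def)
        show "y \<in> insert e (side e y)" using e side_refl assms YX by auto
      qed
      moreover have "e \<in> T e" using not_mem_side e YX by (auto simp: T_def)
      ultimately show False by (auto simp: T_def)
    qed
  qed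
  have "connectedin X (Y - {e})"
  proof -
    define \<U> where "\<U> = {Y \<inter> insert w U |w U. \<exists>V. cut w U V \<and> y \<in> U \<and> e \<in> V}"
    have "Y - {e} \<subseteq> \<Union>\<U>"
    proof
      fix x assume x: "x \<in> Y - {e}"
      then obtain w U V where "cut w U V" "y \<in> U" "x \<in> U" "e \<in> V"
        using sub by (blast elim: mem_sideE)
      then have "Y \<inter> insert w U \<in> \<U>" "x \<in> Y \<inter> insert w U" using x by (auto simp: \<U>_def)
      then show "x \<in> \<Union>\<U>" by blast
    qed
    moreover have "\<Union>\<U> \<subseteq> Y - {e}"
      by (auto simp: \<U>_def cut_def disjnt_iff)
    moreover have "connectedin X (\<Union>\<U>)"
    proof (rule connectedin_Union)
      show "connectedin X S" if "S \<in> \<U>" for S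
        using that continuum_Int[OF Y continuum_cut] by (auto simp: \<U>_def continuum_def)
      have "y \<in> \<Inter>\<U>" using assms by (auto simp: \<U>_def)
      then show "\<Inter>\<U> \<noteq> {}" by blast
    qed
    ultimately show ?thesis by (metis subset_antisym)
  qed
  then show ?thesis using that e by (auto simp: endpoint_def)
qed

text \<open>The least subcontinuum containing \<open>S\<close>; for two points it plays the role of
  the arc between them.\<close>

definition conn_hull :: "'a set \<Rightarrow> 'a set" where
  "conn_hull S = \<Inter>{K. continuum K \<and> S \<subseteq> K}"

lemma continuum_hull: "S \<subseteq> topspace X \<Longrightarrow> continuum (conn_hull S)"
  unfolding conn_hull_def using continuum_topspace by (intro continuum_Inter) auto

lemma hull_superset: "S \<subseteq> conn_hull S"
  unfolding conn_hull_def by blast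

text \<open>The hulls of the three pairs meet pairwise in \<open>a\<close>, \<open>b\<close>,
  \<open>c\<close>, so they share a point \<open>m\<close>. A point of the hull of a pair never has
  both points on one side, which makes the three sides of \<open>m\<close> disjoint. Finally
  \<open>m\<close> differs from \<open>a\<close>, \<open>b\<close>, \<open>c\<close>, because an
  endpoint of \<open>Y\<close> is not in the hull of two other points of \<open>Y\<close>.\<close>

lemma median:
  assumes Y: "continuum Y" and e: "endpoint Y a" "endpoint Y b" "endpoint Y c"
    and ne: "a \<noteq> b" "a \<noteq> c" "b \<noteq> c"
  obtains m where "m \<in> topspace X" "a \<in> side m a" "b \<in> side m b" "c \<in> side m c"
    "disjnt (side m a) (side m b)" "disjnt (side m a) (side m c)" "disjnt (side m b) (side m c)"
proof -
  have YX: "Y \<subseteq> topspace X" using Y closedin_subset by (auto simp: continuum_def)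
  have abc: "a \<in> topspace X" "b \<in> topspace X" "c \<in> topspace X"
    using e YX by (auto simp: endpoint_def)
  have hull_side: "p \<notin> conn_hull {x, y}" if "y \<in> side p x" for p x y
  proof -
    obtain w U V where "cut w U V" "x \<in> U" "y \<in> U" "p \<in> V" using \<open>y \<in> side p x\<close> by (rule mem_sideE)
    then have "continuum (insert w U)" "{x, y} \<subseteq> insert w U" "p \<notin> insert w U"
      using continuum_cut by (auto simp: cut_def disjnt_iff)
    then show ?thesis unfolding conn_hull_def by blast
  qed
  have end_hull: "p \<notin> conn_hull {x, y}" if "endpoint Y p" "x \<in> Y" "y \<in> Y" "x \<noteq> p" "y \<noteq> p" for p x y
  proof (rule hull_side)
    show "y \<in> side p x"
      using connectedin_subset_side[of "Y - {p}" p x] that YX by (auto simp: endpoint_def)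
  qed
  have "conn_hull {a, b} \<inter> conn_hull {a, c} \<inter> conn_hull {b, c} \<noteq> {}"
    using hull_superset[of "{a, b}"] hull_superset[of "{a, c}"] hull_superset[of "{b, c}"] abc
    by (intro continuum_Int3_nonempty continuum_hull) auto
  then obtain m where m: "m \<in> conn_hull {a, b}" "m \<in> conn_hull {a, c}" "m \<in> conn_hull {b, c}" by blast
  have mX: "m \<in> topspace X"
    using m(1) continuum_hull[of "{a, b}"] abc closedin_subset by (auto simp: continuum_def)
  have "m \<noteq> a" "m \<noteq> b" "m \<noteq> c"
    using m end_hull[of a b c] end_hull[of b a c] end_hull[of c a b] e ne by (auto simp: endpoint_def)
  moreover have "b \<notin> side m a" "c \<notin> side m a" "c \<notin> side m b"
    using m hull_side by blast+
  ultimately show ?thesis using that[of m] mX side_refl abc disjnt_side by auto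
qed

end

section \<open>Half-trees of a minimal action\<close>

locale dendron_action = dendron_space X for X :: "'a topology" +
  fixes G :: "('g, 'm) monoid_scheme" (structure) and \<phi> :: "'g \<Rightarrow> 'a \<Rightarrow> 'a"
  assumes acts: "acts_by_homeomorphisms G X \<phi>"
    and infinite_orbit: "x \<in> topspace X \<Longrightarrow> infinite (orbit G \<phi> x)"
begin

lemma homeomorphic: "g \<in> carrier G \<Longrightarrow> homeomorphic_map X X (\<phi> g)"
  using acts by (simp add: acts_by_homeomorphisms_def)

sublocale group_action G "topspace X" \<phi>
  using acts by (simp add: acts_by_homeomorphisms_def)

sublocale group G
  using group_hom by (rule group_hom.axioms(1))

lemma inv_cancel: "g \<in> carrier G \<Longrightarrow> x \<in> topspace X \<Longrightarrow> \<phi> (inv g) (\<phi> g x) = x"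
  using composition_rule[of x "inv g" g] id_eq_one by (metis inv_closed l_inv restrict_apply')

lemma connectedin_image_iff:
  "g \<in> carrier G \<Longrightarrow> S \<subseteq> topspace X \<Longrightarrow> connectedin X (\<phi> g ` S) \<longleftrightarrow> connectedin X S"
  using homeomorphic_map_connectedness[OF homeomorphic] by blast

lemma openin_image: "g \<in> carrier G \<Longrightarrow> openin X S \<Longrightarrow> openin X (\<phi> g ` S)"
  using homeomorphic_map_openness_eq[OF homeomorphic] by blast

lemma closedin_image: "g \<in> carrier G \<Longrightarrow> closedin X S \<Longrightarrow> closedin X (\<phi> g ` S)"
  using homeomorphic_map_closedness_eq[OF homeomorphic] by blast

lemma continuum_image: "g \<in> carrier G \<Longrightarrow> continuum K \<Longrightarrow> continuum (\<phi> g ` K)"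
  using closedin_image[of g K] connectedin_image_iff[of g K] connectedin_subset_topspace[of X K]
  by (simp add: continuum_def)

lemma image_Diff_topspace:
  assumes "g \<in> carrier G" "S \<subseteq> topspace X" "T \<subseteq> topspace X"
  shows "\<phi> g ` (S - T) = \<phi> g ` S - \<phi> g ` T"
  using inj_prop[OF assms(1)] assms by (intro inj_on_image_set_diff) auto

text \<open>Applying \<open>\<phi> g\<close> to a common point of \<open>S\<close> and its translate
  by \<open>inv g \<otimes> h\<close> gives a common point of the two translates.\<close>

lemma translates_meet:
  assumes S: "S \<subseteq> topspace X" "\<And>k. k \<in> carrier G \<Longrightarrow> \<phi> k ` S \<inter> S \<noteq> {}"
    and gh: "g \<in> carrier G" "h \<in> carrier G"
  shows "\<phi> g ` S \<inter> \<phi> h ` S \<noteq> {}"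
proof -
  have k: "inv g \<otimes> h \<in> carrier G" using gh by simp
  obtain y where y: "y \<in> S" "\<phi> (inv g \<otimes> h) y \<in> S" using S(2)[OF k] by blast
  have "\<phi> g (\<phi> (inv g \<otimes> h) y) = \<phi> (g \<otimes> (inv g \<otimes> h)) y"
    using composition_rule[of y g "inv g \<otimes> h"] y S gh by auto
  also have "g \<otimes> (inv g \<otimes> h) = h" using gh by (simp flip: m_assoc)
  finally show ?thesis using y by (metis IntI empty_iff image_eqI)
qed

section \<open>Minimal invariant subcontinua\<close>

text \<open>Inclusion is enough, since applying it to the inverse of \<open>g\<close> turns it into
  equality.\<close>

definition invariant_continuum :: "'a set \<Rightarrow> bool" where
  "invariant_continuum Y \<longleftrightarrow> continuum Y \<and> Y \<noteq> {} \<and> (\<forall>g\<in>carrier G. \<phi> g ` Y \<subseteq> Y)"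

lemma ex_minimal_invariant_continuum:
  assumes "topspace X \<noteq> {}"
  shows "\<exists>Y. invariant_continuum Y \<and> (\<forall>Z. invariant_continuum Z \<longrightarrow> Z \<subseteq> Y \<longrightarrow> Z = Y)"
proof -
  have "\<exists>Y\<in>Collect invariant_continuum. \<forall>Z\<in>Collect invariant_continuum. Z \<subseteq> Y \<longrightarrow> Z = Y"
  proof (rule subset_Zorn_minimal)
    have "invariant_continuum (topspace X)"
      using assms continuum_topspace surj_prop by (auto simp: invariant_continuum_def)
    then show "Collect invariant_continuum \<noteq> {}" by blast
    fix \<C> assume \<C>: "\<C> \<noteq> {}" "subset.chain (Collect invariant_continuum) \<C>"
    then have sub: "\<And>K. K \<in> \<C> \<Longrightarrow> invariant_continuum K" by (auto simp: subset_chain_def)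
    have "\<Inter>\<C> \<inter> topspace X \<noteq> {}"
    proof (rule compact_space_chain_Inter_nonempty[OF compact \<C>(2,1)])
      show "closedin X K" "K \<inter> topspace X \<noteq> {}" if "K \<in> \<C>" for K
        using sub[OF that] closedin_subset[of X K] by (auto simp: invariant_continuum_def continuum_def)
    qed simp
    moreover have "continuum (\<Inter>\<C>)"
      using \<C>(1) sub by (intro continuum_Inter) (auto simp: invariant_continuum_def)
    moreover have "\<phi> g ` \<Inter>\<C> \<subseteq> \<Inter>\<C>" if "g \<in> carrier G" for g
      using sub that unfolding invariant_continuum_def by blast
    ultimately have "\<Inter>\<C> \<in> Collect invariant_continuum" by (auto simp: invariant_continuum_def)
    then show "\<exists>L\<in>Collect invariant_continuum. \<forall>S\<in>\<C>. L \<subseteq> S" by blast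
  qed
  then show ?thesis by blast
qed

end

locale minimal_dendron_action = dendron_action X G \<phi>
  for X :: "'a topology" and G :: "('g, 'm) monoid_scheme" (structure) and \<phi> +
  fixes Y :: "'a set"
  assumes invariant: "invariant_continuum Y"
    and minimal: "invariant_continuum Z \<Longrightarrow> Z \<subseteq> Y \<Longrightarrow> Z = Y"
begin

lemma continuum_Y: "continuum Y"
  and Y_subset: "Y \<subseteq> topspace X"
  and Y_nonempty: "Y \<noteq> {}"
  using invariant closedin_subset by (auto simp: invariant_continuum_def continuum_def)

lemma Y_closed: "g \<in> carrier G \<Longrightarrow> x \<in> Y \<Longrightarrow> \<phi> g x \<in> Y"
  using invariant by (auto simp: invariant_continuum_def)

lemma image_Y:
  assumes "g \<in> carrier G" shows "\<phi> g ` Y = Y"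
proof
  show "\<phi> g ` Y \<subseteq> Y" using Y_closed assms by blast
  have "\<phi> g (\<phi> (inv g) y) = y" if "y \<in> Y" for y
    using inv_cancel[of "inv g" y] assms that Y_subset by auto
  then show "Y \<subseteq> \<phi> g ` Y" using Y_closed assms by (metis image_eqI inv_closed subsetI)
qed

text \<open>Otherwise all translates of \<open>K\<close> and \<open>Y\<close> would meet pairwise, hence have a common point,
  and the intersection of \<open>Y\<close> with all translates would contradict minimality.\<close>

lemma ex_disjoint_translate:
  assumes K: "continuum K" "K \<inter> Y \<noteq> {}" "\<not> Y \<subseteq> K"
  obtains g where "g \<in> carrier G" "\<phi> g ` K \<inter> K = {}"
proof (rule ccontr)
  assume "\<not> thesis"
  then have meet: "\<And>g. g \<in> carrier G \<Longrightarrow> \<phi> g ` K \<inter> K \<noteq> {}" using that by blast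
  have KX: "K \<subseteq> topspace X" using K closedin_subset by (auto simp: continuum_def)
  define \<C> where "\<C> = insert Y ((\<lambda>g. \<phi> g ` K) ` carrier G)"
  have cont: "\<And>L. L \<in> \<C> \<Longrightarrow> continuum L"
    using continuum_Y continuum_image K by (auto simp: \<C>_def)
  have meetY: "\<phi> g ` K \<inter> Y \<noteq> {}" if "g \<in> carrier G" for g
    using K Y_closed[OF that] by blast
  have "L \<inter> M \<noteq> {}" if LM: "L \<in> \<C>" "M \<in> \<C>" for L M
    using LM meetY translates_meet[OF KX meet] Y_nonempty unfolding \<C>_def by blast
  then have ne: "\<Inter>\<C> \<noteq> {}"
    using cont by (intro continuum_Inter_nonempty) (auto simp: \<C>_def)
  have "\<phi> h x \<in> \<Inter>\<C>" if h: "h \<in> carrier G" and x: "x \<in> \<Inter>\<C>" for h x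
  proof -
    have "\<phi> h x \<in> \<phi> g ` K" if g: "g \<in> carrier G" for g
    proof -
      have "inv h \<otimes> g \<in> carrier G" using h g by simp
      then obtain y where y: "y \<in> K" "x = \<phi> (inv h \<otimes> g) y" using x by (auto simp: \<C>_def)
      have "\<phi> h x = \<phi> (h \<otimes> (inv h \<otimes> g)) y"
        using composition_rule[of y h "inv h \<otimes> g"] y KX g h by auto
      also have "h \<otimes> (inv h \<otimes> g) = g" using h g by (simp flip: m_assoc)
      finally show ?thesis using y by blast
    qed
    moreover have "\<phi> h x \<in> Y" using x Y_closed h by (auto simp: \<C>_def)
    ultimately show ?thesis by (auto simp: \<C>_def)
  qed
  then have "invariant_continuum (\<Inter>\<C>)"
    using ne cont continuum_Inter[of \<C>] by (auto simp: invariant_continuum_def \<C>_def)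
  moreover have "\<Inter>\<C> \<subseteq> Y" by (auto simp: \<C>_def)
  ultimately have "\<Inter>\<C> = Y" by (rule minimal)
  moreover have "\<phi> \<one> ` K = K" using KX id_eq_one
    by (metis image_cong image_ident restrict_apply' subsetD)
  then have "\<Inter>\<C> \<subseteq> K" unfolding \<C>_def by blast
  ultimately show False using K(3) by blast
qed

lemma endpoint_image:
  assumes "g \<in> carrier G" "endpoint Y e"
  shows "endpoint Y (\<phi> g e)"
proof -
  have e: "e \<in> Y" "connectedin X (Y - {e})" using assms by (auto simp: endpoint_def)
  then have "\<phi> g ` (Y - {e}) = Y - {\<phi> g e}"
    using image_Diff_topspace[of g Y "{e}"] image_Y assms Y_subset by auto
  then show ?thesis
    using connectedin_image_iff[of g "Y - {e}"] e assms Y_subset Y_closed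
    by (auto simp: endpoint_def)
qed

text \<open>\<open>Y\<close> contains an infinite orbit, so it has two points and hence an endpoint.
  The group permutes the endpoints of \<open>Y\<close>, so the whole infinite orbit of that endpoint
  consists of endpoints.\<close>

lemma infinite_endpoints: "infinite {e. endpoint Y e}"
proof
  assume fin: "finite {e. endpoint Y e}"
  obtain y where y: "y \<in> Y" using Y_nonempty by blast
  have "orbit G \<phi> y \<subseteq> Y" using Y_closed y by (auto simp: orbit_def)
  then have "infinite Y" using infinite_orbit y Y_subset finite_subset by blast
  then have "infinite (Y - {y})" by simp
  then obtain y' where "y' \<in> Y" "y \<noteq> y'" by (metis Diff_iff finite.emptyI insertI1 subsetI subset_empty)
  then obtain e where e: "endpoint Y e" using ex_endpoint[OF continuum_Y y] by blast
  then have "orbit G \<phi> e \<subseteq> {e. endpoint Y e}" using endpoint_image by (auto simp: orbit_def)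
  moreover have "e \<in> topspace X" using e Y_subset by (auto simp: endpoint_def)
  ultimately show False using infinite_orbit fin finite_subset by blast
qed

section \<open>Half-trees and ping-pong\<close>

text \<open>The conditions make the complement of \<open>C\<close> a subcontinuum that meets
  \<open>Y\<close> without containing it, as \<open>ex_disjoint_translate\<close> requires.\<close>

definition half_tree :: "'a set \<Rightarrow> bool" where
  "half_tree C \<longleftrightarrow> openin X C \<and> connectedin X C \<and> connectedin X (topspace X - C) \<and>
     C \<inter> Y \<noteq> {} \<and> Y - C \<noteq> {}"

lemma half_tree_subset: "half_tree C \<Longrightarrow> C \<subseteq> topspace X"
  by (simp add: half_tree_def openin_subset)

lemma half_tree_image:
  assumes g: "g \<in> carrier G" and C: "half_tree C"
  shows "half_tree (\<phi> g ` C)"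
proof -
  have CX: "C \<subseteq> topspace X" using half_tree_subset C .
  have "\<phi> g ` (topspace X - C) = topspace X - \<phi> g ` C"
    using image_Diff_topspace[OF g _ CX] surj_prop[OF g] by simp
  moreover have "\<phi> g ` (Y - C) = Y - \<phi> g ` C"
    using image_Diff_topspace[OF g Y_subset CX] image_Y[OF g] by simp
  moreover have "\<phi> g ` C \<inter> Y \<noteq> {}" using C Y_closed[OF g] unfolding half_tree_def by blast
  ultimately show ?thesis
    using C openin_image[OF g] connectedin_image_iff[OF g, of C]
      connectedin_image_iff[OF g, of "topspace X - C"] CX
    unfolding half_tree_def by (metis Diff_subset image_is_empty)
qed

text \<open>A translate of the complement of \<open>C\<close> that is disjoint from this complement
  has to lie in \<open>C\<close>.\<close>

lemma half_tree_contraction: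
  assumes "half_tree C"
  obtains g where "g \<in> carrier G" "\<phi> g ` (topspace X - C) \<subseteq> C"
proof -
  have "continuum (topspace X - C)" using assms by (auto simp: half_tree_def continuum_def)
  moreover have "(topspace X - C) \<inter> Y \<noteq> {}" "\<not> Y \<subseteq> topspace X - C"
    using assms Y_subset by (auto simp: half_tree_def)
  ultimately obtain g where g: "g \<in> carrier G" "\<phi> g ` (topspace X - C) \<inter> (topspace X - C) = {}"
    by (rule ex_disjoint_translate)
  moreover have "\<phi> g ` (topspace X - C) \<subseteq> topspace X" using surj_prop[OF g(1)] by blast
  ultimately show ?thesis using that by blast
qed

text \<open>The half-trees are the sides of the median of three endpoints of \<open>Y\<close>. Each
  contains one of the endpoints and misses another, so \<open>Y\<close> meets both it and its
  complement.\<close>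

lemma three_half_trees:
  "\<exists>A B C. half_tree A \<and> half_tree B \<and> half_tree C \<and> disjnt A B \<and> disjnt A C \<and> disjnt B C"
proof -
  obtain E where E: "E \<subseteq> {e. endpoint Y e}" "card E = 3"
    using infinite_endpoints by (meson infinite_arbitrarily_large)
  then obtain a b c where abc: "E = {a, b, c}" "a \<noteq> b" "a \<noteq> c" "b \<noteq> c"
    by (auto simp: card_3_iff)
  then have e: "endpoint Y a" "endpoint Y b" "endpoint Y c" using E by auto
  obtain m where m: "m \<in> topspace X" "a \<in> side m a" "b \<in> side m b" "c \<in> side m c"
    "disjnt (side m a) (side m b)" "disjnt (side m a) (side m c)" "disjnt (side m b) (side m c)"
    using median[OF continuum_Y e abc(2-4)] by blast
  have abcY: "a \<in> Y" "b \<in> Y" "c \<in> Y" using e by (auto simp: endpoint_def)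
  have "half_tree (side m x)" if "x \<in> side m x" "x \<in> Y" "y \<in> Y" "y \<notin> side m x" for x y
    using that openin_side connectedin_side continuum_Diff_side[OF m(1)]
    by (auto simp: half_tree_def continuum_def)
  then have "half_tree (side m a)" "half_tree (side m b)" "half_tree (side m c)"
    using m abcY unfolding disjnt_iff by blast+
  then show ?thesis using m by blast
qed

text \<open>Ping-pong: in a family of at least three disjoint half-trees, one of them can be replaced
  by the translates of all the others into it.\<close>

lemma many_half_trees:
  "\<exists>\<C>. finite \<C> \<and> n + 3 \<le> card \<C> \<and> pairwise disjnt \<C> \<and> (\<forall>C\<in>\<C>. half_tree C)"
proof (induction n)
  case 0
  obtain A B C where ABC: "half_tree A" "half_tree B" "half_tree C"
    and disj: "disjnt A B" "disjnt A C" "disjnt B C"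
    using three_half_trees by blast
  then have "A \<noteq> {}" "B \<noteq> {}" "C \<noteq> {}" unfolding half_tree_def by blast+
  then have "A \<noteq> B" "A \<noteq> C" "B \<noteq> C" using disj by (metis disjnt_self_iff_empty)+
  then have "card {A, B, C} = 3" by simp
  moreover have "pairwise disjnt {A, B, C}"
    unfolding pairwise_insert using disj disjnt_sym by auto
  ultimately show ?case using ABC by (intro exI[of _ "{A, B, C}"]) simp
next
  case (Suc n)
  then obtain \<C> where \<C>: "finite \<C>" "n + 3 \<le> card \<C>" "pairwise disjnt \<C>" "\<And>C. C \<in> \<C> \<Longrightarrow> half_tree C"
    by blast
  then obtain C where C: "C \<in> \<C>" by fastforce
  obtain g where g: "g \<in> carrier G" "\<phi> g ` (topspace X - C) \<subseteq> C"
    using half_tree_contraction \<C>(4)[OF C] by blast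
  define \<D> where "\<D> = \<C> - {C}"
  have DX: "D \<subseteq> topspace X - C" "D \<noteq> {}" if "D \<in> \<D>" for D
  proof -
    have "D \<in> \<C>" "D \<noteq> C" using that by (auto simp: \<D>_def)
    then have "disjnt D C" "half_tree D" using \<C>(3,4) C by (auto simp: pairwise_def)
    then show "D \<subseteq> topspace X - C" "D \<noteq> {}"
      using half_tree_subset[of D] by (auto simp: disjnt_iff half_tree_def)
  qed
  have into: "\<phi> g ` D \<subseteq> C" if "D \<in> \<D>" for D
    using DX[OF that] g(2) by blast
  have inj: "inj_on (\<phi> g) (topspace X)" using inj_prop g by blast
  have inj': "inj_on ((`) (\<phi> g)) \<D>"
    using DX inj by (intro inj_onI) (metis Diff_subset inj_on_image_eq_iff subset_trans)
  have disj: "\<D> \<inter> (`) (\<phi> g) ` \<D> = {}"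
    using DX into by (auto simp: disjoint_iff) blast
  have "card (\<D> \<union> (`) (\<phi> g) ` \<D>) = 2 * card \<D>"
    using \<C>(1) disj inj' by (subst card_Un_disjoint) (auto simp: \<D>_def card_image)
  moreover have "card \<D> = card \<C> - 1" using C \<C>(1) by (simp add: \<D>_def)
  \<comment> \<open>With m half-trees the new family has 2(m - 1) members, which exceeds m exactly
    when m is at least 3.\<close>
  ultimately have "Suc n + 3 \<le> card (\<D> \<union> (`) (\<phi> g) ` \<D>)" using \<C>(2) by linarith
  moreover have "pairwise disjnt (\<D> \<union> (`) (\<phi> g) ` \<D>)"
  proof -
    have 1: "disjnt A B" if "A \<in> \<D>" "B \<in> \<D>" "A \<noteq> B" for A B
      using that \<C>(3) by (auto simp: \<D>_def pairwise_def)
    have 2: "disjnt A (\<phi> g ` B)" if "A \<in> \<D>" "B \<in> \<D>" for A B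
      using DX[OF that(1)] into[OF that(2)] by (auto simp: disjnt_iff)
    have 3: "disjnt (\<phi> g ` A) (\<phi> g ` B)" if AB: "A \<in> \<D>" "B \<in> \<D>" "\<phi> g ` A \<noteq> \<phi> g ` B" for A B
      using 1[OF AB(1,2)] AB(3) inj_on_image_Int[OF inj, of A B] DX[OF AB(1)] DX[OF AB(2)]
      by (auto simp: disjnt_def)
    show ?thesis
    proof (rule pairwiseI)
      fix A B assume AB: "A \<in> \<D> \<union> (`) (\<phi> g) ` \<D>" "B \<in> \<D> \<union> (`) (\<phi> g) ` \<D>" "A \<noteq> B"
      from AB(1,2) show "disjnt A B"
        by (elim UnE imageE) (use AB(3) 1 2 disjnt_sym[OF 2] 3 in simp_all)
    qed
  qed
  moreover have "half_tree D" if "D \<in> \<D> \<union> (`) (\<phi> g) ` \<D>" for D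
    using that \<C>(4) half_tree_image[OF g(1)] by (auto simp: \<D>_def)
  ultimately show ?case
    using \<C>(1) by (intro exI[of _ "\<D> \<union> (`) (\<phi> g) ` \<D>"]) (auto simp: \<D>_def)
qed

end

section \<open>Concentration of measures\<close>

lemma space_borel_of: "space (borel_of X) = topspace X"
  unfolding borel_of_def by (rule space_measure_of) (auto dest: openin_subset)

lemma openin_sets_borel_of: "openin X U \<Longrightarrow> U \<in> sets (borel_of X)"
  unfolding borel_of_def by (subst sets_measure_of) (auto dest: openin_subset)

lemma measurable_borel_of:
  assumes "f \<in> space M \<rightarrow> topspace X" "\<And>U. openin X U \<Longrightarrow> f -` U \<inter> space M \<in> sets M"
  shows "f \<in> measurable M (borel_of X)"
  unfolding borel_of_def
  by (rule measurable_measure_of) (use assms in \<open>auto dest: openin_subset\<close>)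

lemma continuous_map_measurable:
  assumes "continuous_map X Z f" shows "f \<in> measurable (borel_of X) (borel_of Z)"
proof (rule measurable_borel_of)
  show "f \<in> space (borel_of X) \<rightarrow> topspace Z"
    using assms by (simp add: space_borel_of continuous_map_funspace)
  fix U assume "openin Z U"
  then have "openin X {x \<in> topspace X. f x \<in> U}" using assms by (rule openin_continuous_map_preimage[rotated])
  moreover have "{x \<in> topspace X. f x \<in> U} = f -` U \<inter> space (borel_of X)"
    by (auto simp: space_borel_of)
  ultimately show "f -` U \<inter> space (borel_of X) \<in> sets (borel_of X)"
    by (metis openin_sets_borel_of)
qed

lemma continuous_map_borel_measurable:
  fixes f :: "'a \<Rightarrow> 'b :: topological_space"
  assumes "continuous_map X euclidean f" shows "f \<in> borel_measurable (borel_of X)"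
  using continuous_map_measurable[OF assms] by (simp add: borel_of_def borel_def)

lemma limitin_pullback_topology:
  assumes "\<forall>\<^sub>F i in F. h i \<in> A" "l \<in> A" "limitin T (\<lambda>i. f (h i)) (f l) F"
  shows "limitin (pullback_topology A f T) h l F"
  unfolding limitin_def
proof (intro conjI allI impI)
  show "l \<in> topspace (pullback_topology A f T)"
    using assms limitin_topspace[OF assms(3)] by (simp add: topspace_pullback_topology)
  fix S assume "openin (pullback_topology A f T) S \<and> l \<in> S"
  then obtain U where U: "openin T U" "S = f -` U \<inter> A" "f l \<in> U"
    by (auto simp: openin_pullback_topology)
  then have "\<forall>\<^sub>F i in F. f (h i) \<in> U" using assms(3) by (auto simp: limitin_def)
  with assms(1) show "\<forall>\<^sub>F i in F. h i \<in> S" by eventually_elim (simp add: U)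
qed

text \<open>Limits in a product topology are taken coordinatewise, so it suffices to treat the
  integral of one continuous function at a time.\<close>

lemma limitin_weak_star_topologyI:
  assumes "\<forall>\<^sub>F i in F. h i \<in> borel_prob_measures X" "l \<in> borel_prob_measures X"
    and "\<And>f. continuous_map X euclideanreal f \<Longrightarrow> ((\<lambda>i. \<integral>x. f x \<partial>h i) \<longlongrightarrow> (\<integral>x. f x \<partial>l)) F"
  shows "limitin (weak_star_topology X) h l F"
  unfolding weak_star_topology_def
proof (rule limitin_pullback_topology[OF assms(1,2)])
  show "limitin (product_topology (\<lambda>_. euclideanreal) {f. continuous_map X euclideanreal f})
     (\<lambda>i. \<lambda>f\<in>{f. continuous_map X euclideanreal f}. \<integral>x. f x \<partial>h i)
     (\<lambda>f\<in>{f. continuous_map X euclideanreal f}. \<integral>x. f x \<partial>l) F"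
    unfolding limitin_componentwise using assms(3) by simp
qed

lemma return_borel_prob_measures:
  "z \<in> topspace X \<Longrightarrow> return (borel_of X) z \<in> borel_prob_measures X"
  by (simp add: borel_prob_measures_def prob_space_return space_borel_of)

section \<open>Events of small measure and connected sets of small diameter\<close>

text \<open>If all of at least \<open>n\<close> disjoint events had probability above
  \<open>1 / n\<close>, their union would have probability above 1.\<close>

lemma (in prob_space) ex_small_event:
  assumes "finite \<C>" "n \<le> card \<C>" "0 < n" "pairwise disjnt \<C>" "\<C> \<subseteq> events"
  shows "\<exists>C\<in>\<C>. prob C \<le> 1 / real n"
proof (rule ccontr)
  assume "\<not> ?thesis"
  then have big: "1 / real n < prob C" if "C \<in> \<C>" for C using that by force
  have "\<C> \<noteq> {}" using assms by auto
  have "1 \<le> real (card \<C>) * (1 / real n)" using assms by (simp add: field_simps)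
  also have "\<dots> = (\<Sum>C\<in>\<C>. 1 / real n)" by simp
  also have "\<dots> < (\<Sum>C\<in>\<C>. prob C)" using big \<open>\<C> \<noteq> {}\<close> assms(1) by (intro sum_strict_mono) auto
  also have "\<dots> = prob (\<Union>C\<in>\<C>. C)"
    using assms by (intro finite_measure_finite_Union[symmetric])
      (auto simp: disjoint_family_on_def pairwise_def disjnt_def)
  also have "\<dots> \<le> 1" by simp
  finally show False by simp
qed

text \<open>A finite form of the fact that disjoint connected sets have diameters tending to zero:
  cover the square of \<open>X\<close> by small squares and by products \<open>U \<times> V\<close> of the two sides
  of a cut point; the cut points of a finite subcover form \<open>P\<close>.\<close>

lemma (in dendron_space) finite_blocking_set:
  assumes "Metric_space M d" "X = Metric_space.mtopology M d" "0 < \<epsilon>"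
  obtains P where "finite P"
    "\<And>S x y. connectedin X S \<Longrightarrow> S \<inter> P = {} \<Longrightarrow> x \<in> S \<Longrightarrow> y \<in> S \<Longrightarrow> d x y < \<epsilon>"
proof -
  interpret Metric_space M d by fact
  have XM: "topspace X = M" using assms(2) by simp
  define \<B> where "\<B> = (\<lambda>x. mball x (\<epsilon>/2) \<times> mball x (\<epsilon>/2)) ` M"
  define \<W> where "\<W> = {U \<times> V |U V. \<exists>w. cut w U V}"
  have "compactin (prod_topology X X) (topspace (prod_topology X X))"
    using compact compact_space_prod_topology compact_space_def by blast
  moreover have "openin (prod_topology X X) S" if "S \<in> \<B> \<union> \<W>" for S
  proof -
    have "openin X (mball x (\<epsilon>/2))" for x using assms(2) by simp
    then show ?thesis using that unfolding \<B>_def \<W>_def cut_def by (auto simp: openin_prod_Times_iff)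
  qed
  moreover have "topspace (prod_topology X X) \<subseteq> \<Union>(\<B> \<union> \<W>)"
  proof
    fix p assume "p \<in> topspace (prod_topology X X)"
    then obtain x y where p: "p = (x, y)" "x \<in> M" "y \<in> M" by (auto simp: XM)
    show "p \<in> \<Union>(\<B> \<union> \<W>)"
    proof (cases "x = y")
      case True
      then have "p \<in> mball x (\<epsilon>/2) \<times> mball x (\<epsilon>/2)" using p assms(3) by simp
      then show ?thesis using p(2) unfolding \<B>_def by blast
    next
      case False
      then obtain w U V where "cut w U V" "x \<in> U" "y \<in> V" using ex_cut p XM by blast
      then have "p \<in> U \<times> V" "U \<times> V \<in> \<W>" using p by (auto simp: \<W>_def)
      then show ?thesis by blast
    qed
  qed
  ultimately obtain \<F> where \<F>: "finite \<F>" "\<F> \<subseteq> \<B> \<union> \<W>" "topspace (prod_topology X X) \<subseteq> \<Union>\<F>"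
    unfolding compactin_def by meson
  \<comment> \<open>For members of the subcover that are not products of two cut sides the chosen
    point is arbitrary; such points merely enlarge the blocking set.\<close>
  define sep where "sep F = (SOME w. \<exists>U V. F = U \<times> V \<and> cut w U V)" for F
  have sep: "\<exists>U V. F = U \<times> V \<and> cut (sep F) U V" if "F \<in> \<W>" for F
    unfolding sep_def by (rule someI_ex) (use that in \<open>auto simp: \<W>_def\<close>)
  show ?thesis
  proof (rule that[of "sep ` \<F>"])
    fix S x y assume S: "connectedin X S" "S \<inter> sep ` \<F> = {}" "x \<in> S" "y \<in> S"
    then have "x \<in> M" "y \<in> M" using connectedin_subset_topspace XM by blast+
    then obtain F where F: "F \<in> \<F>" "(x, y) \<in> F" using \<F>(3) XM by auto
    show "d x y < \<epsilon>"
    proof (cases "F \<in> \<W>")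
      case True
      then obtain U V where UV: "F = U \<times> V" "cut (sep F) U V" using sep by blast
      \<comment> \<open>A connected set with points on both sides of a cut contains the cut
        point.\<close>
      then have "sep F \<in> S"
        using connectedin_imp_cut_convex[OF S(1)] F(2) S(3,4) unfolding cut_convex_def by blast
      then show ?thesis using S(2) F(1) by blast
    next
      case False
      then have "F \<in> \<B>" using F(1) \<F>(2) by blast
      then obtain z where "x \<in> mball z (\<epsilon>/2)" "y \<in> mball z (\<epsilon>/2)"
        unfolding \<B>_def using F(2) by blast
      then show ?thesis using triangle[of x z y] commute[of x z] by auto
    qed
  qed (use \<F> in simp)
qed

section \<open>Limits of translated measures\<close>

context minimal_dendron_action
begin

text \<open>Among sufficiently many disjoint half-trees at least \<open>n\<close> avoid the finite
  blocking set, so they are small in diameter, and one of these has measure at most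
  \<open>1 / n\<close>. The element \<open>g\<close> contracting its complement into it can fail to
  send only points of \<open>C\<close> itself into \<open>C\<close>.\<close>

lemma ex_concentrating_translate:
  assumes M: "Metric_space M d" "X = Metric_space.mtopology M d" "0 < \<epsilon>"
    and \<mu>: "\<mu> \<in> borel_prob_measures X" and n: "0 < n"
  obtains g C where "g \<in> carrier G" "openin X C" "C \<noteq> {}" "\<forall>x\<in>C. \<forall>y\<in>C. d x y < \<epsilon>"
    "measure \<mu> {x \<in> topspace X. \<phi> g x \<notin> C} \<le> 1 / real n"
proof -
  interpret prob_space \<mu> using \<mu> by (simp add: borel_prob_measures_def)
  have sets: "sets \<mu> = sets (borel_of X)" using \<mu> by (simp add: borel_prob_measures_def)
  obtain P where P: "finite P"
    "\<And>S x y. connectedin X S \<Longrightarrow> S \<inter> P = {} \<Longrightarrow> x \<in> S \<Longrightarrow> y \<in> S \<Longrightarrow> d x y < \<epsilon>"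
    using finite_blocking_set[OF M] by blast
  obtain \<C> where \<C>: "finite \<C>" "card P + n + 3 \<le> card \<C>" "pairwise disjnt \<C>" "\<And>C. C \<in> \<C> \<Longrightarrow> half_tree C"
    using many_half_trees[of "card P + n"] by blast
  define \<D> where "\<D> = {C \<in> \<C>. C \<inter> P = {}}"
  \<comment> \<open>Each point of \<open>P\<close> lies in at most one of the disjoint half-trees,
    so choosing a point of \<open>P\<close> in every half-tree that meets \<open>P\<close> is
    injective.\<close>
  have "card (\<C> - \<D>) \<le> card P"
  proof -
    define f where "f C = (SOME p. p \<in> C \<inter> P)" for C
    have f: "f C \<in> C \<inter> P" if "C \<in> \<C> - \<D>" for C
      unfolding f_def by (rule someI_ex) (use that in \<open>auto simp: \<D>_def\<close>)
    have "inj_on f (\<C> - \<D>)"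
    proof (rule inj_onI)
      fix A B assume AB: "A \<in> \<C> - \<D>" "B \<in> \<C> - \<D>" "f A = f B"
      then have "f A \<in> A" "f A \<in> B" using f[of A] f[of B] by auto
      then show "A = B" using AB \<C>(3) unfolding pairwise_def disjnt_iff by blast
    qed
    then show ?thesis using f P(1) by (intro card_inj_on_le[of f]) blast+
  qed
  moreover have "card (\<C> - \<D>) = card \<C> - card \<D>"
    using \<C>(1) by (intro card_Diff_subset) (auto simp: \<D>_def)
  ultimately have "n \<le> card \<D>" using \<C>(2) by linarith
  moreover have "pairwise disjnt \<D>" using \<C>(3) by (auto simp: \<D>_def pairwise_def)
  moreover have "\<D> \<subseteq> events"
    using \<C>(4) openin_sets_borel_of sets by (auto simp: \<D>_def half_tree_def)
  ultimately obtain C where C: "C \<in> \<D>" "prob C \<le> 1 / real n"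
    using ex_small_event[of \<D> n] n \<C>(1) by (auto simp: \<D>_def)
  then have half: "half_tree C" "C \<inter> P = {}" using \<C>(4) by (auto simp: \<D>_def)
  then obtain g where g: "g \<in> carrier G" "\<phi> g ` (topspace X - C) \<subseteq> C"
    using half_tree_contraction by blast
  have "prob {x \<in> topspace X. \<phi> g x \<notin> C} \<le> prob C"
    using g(2) C(1) \<open>\<D> \<subseteq> events\<close> by (intro finite_measure_mono) auto
  then have "prob {x \<in> topspace X. \<phi> g x \<notin> C} \<le> 1 / real n" using C(2) by simp
  moreover have "openin X C" "connectedin X C" "C \<noteq> {}" using half(1) by (auto simp: half_tree_def)
  moreover have "\<forall>x\<in>C. \<forall>y\<in>C. d x y < \<epsilon>" using P(2)[OF _ half(2)] calculation by blast
  ultimately show ?thesis using that[OF g(1)] by blast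
qed

text \<open>The small sets \<open>C k\<close> receive all but \<open>1 / (k + 1)\<close> of the mass
  under \<open>g k\<close>. Along a subsequence they shrink to a point \<open>z\<close> by
  compactness, and the translated measures converge to the point mass at \<open>z\<close>.\<close>

lemma action_strongly_proximal:
  assumes "metrizable_space X"
  shows "strongly_proximal G X \<phi>"
  unfolding strongly_proximal_def
proof
  fix \<mu> assume \<mu>: "\<mu> \<in> borel_prob_measures X"
  interpret prob_space \<mu> using \<mu> by (simp add: borel_prob_measures_def)
  have sets: "sets \<mu> = sets (borel_of X)" using \<mu> by (simp add: borel_prob_measures_def)
  then have space: "space \<mu> = topspace X" using sets_eq_imp_space_eq space_borel_of by metis
  obtain M d where Md: "Metric_space M d" "X = Metric_space.mtopology M d"
    using assms unfolding metrizable_space_def by blast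
  interpret Metric_space M d by fact
  have XM: "topspace X = M" using Md by simp
  define near where "near k g C \<longleftrightarrow> g \<in> carrier G \<and> openin X C \<and> C \<noteq> {} \<and>
    (\<forall>x\<in>C. \<forall>y\<in>C. d x y < 1 / real (Suc k)) \<and>
    measure \<mu> {x \<in> topspace X. \<phi> g x \<notin> C} \<le> 1 / real (Suc k)" for k g C
  have "\<exists>g C. near k g C" for k
  proof -
    have "0 < 1 / real (Suc k)" by simp
    from ex_concentrating_translate[OF Md this \<mu> zero_less_Suc[of k]]
    obtain g C where "g \<in> carrier G" "openin X C" "C \<noteq> {}" "\<forall>x\<in>C. \<forall>y\<in>C. d x y < 1 / real (Suc k)"
      "measure \<mu> {x \<in> topspace X. \<phi> g x \<notin> C} \<le> 1 / real (Suc k)" .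
    then have "near k g C" unfolding near_def by blast
    then show ?thesis by blast
  qed
  then obtain g C where near: "\<And>k. near k (g k) (C k)" by metis
  then have g: "\<And>k. g k \<in> carrier G" and C: "\<And>k. openin X (C k)" "\<And>k. C k \<noteq> {}"
    "\<And>k x y. x \<in> C k \<Longrightarrow> y \<in> C k \<Longrightarrow> d x y < 1 / real (Suc k)"
    "\<And>k. measure \<mu> {x \<in> topspace X. \<phi> (g k) x \<notin> C k} \<le> 1 / real (Suc k)"
    by (simp_all add: near_def)
  define c where "c k = (SOME x. x \<in> C k)" for k
  have c: "c k \<in> C k" for k using C(2) by (simp add: c_def some_in_eq)
  then have cM: "range c \<subseteq> M" using C(1) openin_subset XM by blast
  then obtain z r where z: "z \<in> M" and r: "strict_mono r"
    and lim: "limitin mtopology (c \<circ> r) z sequentially"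
    using compact Md(2) compact_space_sequentially by blast
  \<comment> \<open>Eventually both the distance from \<open>c (r k)\<close> to \<open>z\<close> and
    the diameter bound for \<open>C (r k)\<close> are below \<open>\<delta> / 2\<close>.\<close>
  have C_near: "\<forall>\<^sub>F k in sequentially. C (r k) \<subseteq> W" if W: "openin X W" "z \<in> W" for W
  proof -
    obtain \<delta> where \<delta>: "0 < \<delta>" "mball z \<delta> \<subseteq> W" using W Md(2) openin_mtopology by blast
    have "\<forall>\<^sub>F k in sequentially. d (c (r k)) z < \<delta> / 2"
      using lim \<delta>(1) unfolding limit_metric_sequentially eventually_sequentially o_def by (meson half_gt_zero)
    moreover have "\<forall>\<^sub>F k in sequentially. 1 / real (Suc k) < \<delta> / 2"
      using \<delta>(1) by real_asymp
    ultimately show ?thesis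
    proof eventually_elim
      case (elim k)
      \<comment> \<open>A strictly increasing \<open>r\<close> satisfies \<open>k \<le> r k\<close>,
        so the bounds survive the passage to the subsequence.\<close>
      have "1 / real (Suc (r k)) \<le> 1 / real (Suc k)"
        using strict_mono_imp_increasing[OF r, of k] by (intro divide_left_mono) auto
      show ?case
      proof
        fix x assume x: "x \<in> C (r k)"
        then have xM: "x \<in> M" "c (r k) \<in> M" using C(1) openin_subset XM cM by blast+
        have "d z x \<le> d z (c (r k)) + d (c (r k)) x" using triangle z xM by blast
        also have "\<dots> < \<delta> / 2 + \<delta> / 2"
          using C(3)[OF c x] elim commute[of z] \<open>1 / real (Suc (r k)) \<le> 1 / real (Suc k)\<close> by auto
        finally show "x \<in> W" using \<delta>(2) z xM by (auto simp: subset_iff)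
      qed
    qed
  qed
  have \<phi>_meas: "\<phi> (g k) \<in> measurable \<mu> (borel_of X)" for k
    using continuous_map_measurable[OF homeomorphic_imp_continuous_map[OF homeomorphic[OF g]]]
      measurable_cong_sets[OF sets refl] by blast
  define F where "F = filtermap (g \<circ> r) sequentially"
  have "limitin (weak_star_topology X) (\<lambda>g. distr \<mu> (borel_of X) (\<phi> g)) (return (borel_of X) z) F"
  proof (rule limitin_weak_star_topologyI)
    show "return (borel_of X) z \<in> borel_prob_measures X"
      using return_borel_prob_measures z XM by metis
    show "\<forall>\<^sub>F h in F. distr \<mu> (borel_of X) (\<phi> h) \<in> borel_prob_measures X"
      using prob_space_distr[OF \<phi>_meas] by (simp add: F_def eventually_filtermap borel_prob_measures_def)
    fix f assume f: "continuous_map X euclideanreal f"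
    have f_meas: "f \<in> borel_measurable (borel_of X)" using continuous_map_borel_measurable[OF f] .
    have "compactin euclideanreal (f ` topspace X)"
      using image_compactin f compact compact_space_def by metis
    then have "bounded (f ` topspace X)" by (simp add: compact_imp_bounded)
    then obtain B where B: "0 < B" "\<And>x. x \<in> topspace X \<Longrightarrow> \<bar>f x\<bar> \<le> B"
      unfolding bounded_pos by auto
    have return: "(\<integral>x. f x \<partial>return (borel_of X) z) = f z"
      using integral_return[of z "borel_of X" f] f_meas z XM by (simp add: space_borel_of)
    have distr: "(\<integral>x. f x \<partial>distr \<mu> (borel_of X) (\<phi> (g k))) = (\<integral>x. f (\<phi> (g k) x) \<partial>\<mu>)" for k
      by (rule integral_distr[OF \<phi>_meas f_meas])
    have "(\<lambda>k. \<integral>x. f (\<phi> (g (r k)) x) \<partial>\<mu>) \<longlonglongrightarrow> f z"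
    proof (rule tendstoI)
      fix e :: real assume e: "0 < e"
      define W where "W = {x \<in> topspace X. f x \<in> {f z - e/2 <..< f z + e/2}}"
      have "openin X W" unfolding W_def using f by (rule openin_continuous_map_preimage) simp
      moreover have "z \<in> W" using e z XM by (auto simp: W_def)
      ultimately have "\<forall>\<^sub>F k in sequentially. C (r k) \<subseteq> W" by (rule C_near)
      moreover have "\<forall>\<^sub>F k in sequentially. 2 * B * (1 / real (Suc k)) < e / 2"
        using e B(1) by real_asymp
      ultimately show "\<forall>\<^sub>F k in sequentially. dist (\<integral>x. f (\<phi> (g (r k)) x) \<partial>\<mu>) (f z) < e"
      proof eventually_elim
        case (elim k)
        \<comment> \<open>The exceptional set: off \<open>N\<close> the integrand is within
          \<open>e / 2\<close> of \<open>f z\<close>, on \<open>N\<close> it differs by at most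
          \<open>2 * B\<close>, and \<open>N\<close> has small measure.\<close>
        define N where "N = {x \<in> topspace X. \<phi> (g (r k)) x \<notin> C (r k)}"
        have N_eq: "N = space \<mu> - (\<phi> (g (r k)) -` C (r k) \<inter> space \<mu>)"
          by (auto simp: N_def space)
        have N: "N \<in> events"
          unfolding N_eq using measurable_sets[OF \<phi>_meas openin_sets_borel_of[OF C(1)]] by blast
        have "1 / real (Suc (r k)) \<le> 1 / real (Suc k)"
          using strict_mono_imp_increasing[OF r, of k] by (intro divide_left_mono) auto
        then have "prob N \<le> 1 / real (Suc k)" using C(4)[of "r k"] unfolding N_def by linarith
        then have N_small: "2 * B * prob N < e / 2"
          using elim(2) B(1) by (smt (verit, best) mult_left_mono)
        have \<phi>X: "\<phi> (g (r k)) x \<in> topspace X" if "x \<in> topspace X" for x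
          using element_image[OF g that] by blast
        have f\<phi>: "integrable \<mu> (\<lambda>x. f (\<phi> (g (r k)) x))"
          using B(2) \<phi>X by (intro integrable_const_bound[of _ B] measurable_compose[OF \<phi>_meas f_meas])
            (auto simp: space)
        have "(\<integral>x. f (\<phi> (g (r k)) x) \<partial>\<mu>) - f z = (\<integral>x. f (\<phi> (g (r k)) x) - f z \<partial>\<mu>)"
          using f\<phi> by (simp add: prob_space)
        also have "\<bar>\<dots>\<bar> \<le> (\<integral>x. \<bar>f (\<phi> (g (r k)) x) - f z\<bar> \<partial>\<mu>)" by (rule integral_abs_bound)
        also have "\<dots> \<le> (\<integral>x. e / 2 + 2 * B * indicator N x \<partial>\<mu>)"
        proof (rule integral_mono)
          show "integrable \<mu> (\<lambda>x. \<bar>f (\<phi> (g (r k)) x) - f z\<bar>)" using f\<phi> by simp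
          show "integrable \<mu> (\<lambda>x. e / 2 + 2 * B * indicator N x)"
            using N by (intro Bochner_Integration.integrable_add integrable_mult_right) (auto simp: emeasure_eq_measure)
          fix x assume x: "x \<in> space \<mu>"
          show "\<bar>f (\<phi> (g (r k)) x) - f z\<bar> \<le> e / 2 + 2 * B * indicator N x"
          proof (cases "x \<in> N")
            case True
            then show ?thesis
              using B(2)[of z] B(2)[OF \<phi>X[of x]] x z XM space e by auto
          next
            case False
            then have "\<phi> (g (r k)) x \<in> W" using x elim(1) by (auto simp: N_def space)
            then have "f z - e/2 < f (\<phi> (g (r k)) x)" "f (\<phi> (g (r k)) x) < f z + e/2"
              by (auto simp: W_def)
            then have "\<bar>f (\<phi> (g (r k)) x) - f z\<bar> \<le> e / 2" by linarith
            then show ?thesis using False by simp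
          qed
        qed
        also have "\<dots> = e / 2 + 2 * B * prob N"
          using N by (simp add: prob_space emeasure_eq_measure)
        finally show ?case using N_small by (simp add: dist_real_def)
      qed
    qed
    then show "((\<lambda>h. \<integral>x. f x \<partial>distr \<mu> (borel_of X) (\<phi> h)) \<longlongrightarrow> (\<integral>x. f x \<partial>return (borel_of X) z)) F"
      unfolding F_def filterlim_filtermap return by (simp add: distr)
  qed
  moreover have "F \<noteq> bot" by (simp add: F_def filtermap_bot_iff)
  moreover have "F \<le> principal (carrier G)"
    using g by (simp add: F_def le_principal eventually_filtermap)
  ultimately show "\<exists>F. \<exists>z\<in>topspace X. F \<noteq> bot \<and> F \<le> principal (carrier G) \<and>
      limitin (weak_star_topology X) (\<lambda>g. distr \<mu> (borel_of X) (\<phi> g)) (return (borel_of X) z) F"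
    using z XM by blast
qed

end

theorem theorem5p5:
  fixes G :: "('g, 'm) monoid_scheme" and X :: "'a topology" and \<phi> :: "'g \<Rightarrow> 'a \<Rightarrow> 'a"
  assumes "dendrite X"
    and "acts_by_homeomorphisms G X \<phi>"
    and "\<And>x. x \<in> topspace X \<Longrightarrow> infinite (orbit G \<phi> x)"
  shows "strongly_proximal G X \<phi>"
proof (cases "topspace X = {}")
  case True
  \<comment> \<open>The empty space carries no probability measure, so the claim is vacuous; a
    nonempty space is what yields a minimal invariant subcontinuum.\<close>
  then have "\<not> prob_space \<mu>" if "sets \<mu> = sets (borel_of X)" for \<mu>
    using prob_space.not_empty[of \<mu>] sets_eq_imp_space_eq[OF that] by (auto simp: space_borel_of)
  then have "borel_prob_measures X = {}" by (auto simp: borel_prob_measures_def)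
  then show ?thesis by (simp add: strongly_proximal_def)
next
  case False
  interpret dendron_action X G \<phi>
    using assms by unfold_locales (auto simp: dendrite_def)
  obtain Y where "invariant_continuum Y" "\<And>Z. invariant_continuum Z \<Longrightarrow> Z \<subseteq> Y \<Longrightarrow> Z = Y"
    using ex_minimal_invariant_continuum[OF False] by blast
  then interpret minimal_dendron_action X G \<phi> Y by unfold_locales
  show ?thesis using action_strongly_proximal assms(1) by (simp add: dendrite_def)
qed

end
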